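(* Let $\Gamma$ and $\Gamma_0$ be subgroups of $\mathrm{PSL}_2(\mathbb{C})$. If $\Gamma_0$ is a finite-index subgroup of $\Gamma$, then $\Gamma$ satisfies the BH condition if and only if $\Gamma_0$ satisfies the BH condition.
   Context: $\hat{\mathbb{C}}$ is the Riemann sphere, on which $\mathrm{PSL}_2(\mathbb{C})$ acts by Möbius transformations. $\mathcal{K}$ denotes the set of non-empty compact subsets of $\hat{\mathbb{C}}$ with the Hausdorff distance, and $\mathcal{K}_0\subset\mathcal{K}$ is the subset of those elements that are not singletons, with the subspace topology. $\mathrm{PSL}_2(\mathbb{C})$ acts on $\mathcal{K}$ and $\mathcal{K}_0$ by $g\cdot A=g(A)$. A Jordan curve on $\hat{\mathbb{C}}$ is a simple closed curve (image of a continuous injective map $S^1\to\hat{\mathbb{C}}$), regarded as an element of $\mathcal{K}_0$. For $K\ge 1$, an orientation-preserving homeomorphism $h$ between domains of $\hat{\mathbb{C}}$ is $K$-quasiconformal if it is absolutely continuous on lines and $|h_{\bar z}|\le \frac{K-1}{K+1}|h_z|$ almost everywhere. A $K$-quasicircle is a Jordan curve which is the image of a round circle under a $K$-quasiconformal homeomorphism of $\hat{\mathbb{C}}$. A subgroup $\Gamma$ of $\mathrm{PSL}_2(\mathbb{C})$ satisfies the BH (Benoist--Hulin) condition if for every closed $\Gamma$-invariant subset $\mathcal{C}$ of $\mathcal{K}_0$ all of whose elements are Jordan curves, there exists $K\ge 1$ such that every element of $\mathcal{C}$ is a $K$-quasicircle. Subgroups are not assumed discrete or closed. *)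

theory Defs
  imports "HOL-Complex_Analysis.Winding_Numbers" "HOL-Algebra.Coset"
begin

section \<open>The Riemann sphere\<close>

datatype rsphere = Affine (coord: complex) | Infty

text \<open>Stereographic projection onto the unit sphere of \<^typ>\<open>complex \<times> real\<close>. The metric on
  the Riemann sphere is the resulting chordal metric.\<close>

primrec stereo :: "rsphere \<Rightarrow> complex \<times> real" where
  "stereo (Affine z) =
     (2 * z / of_real (1 + (norm z)\<^sup>2), ((norm z)\<^sup>2 - 1) / (1 + (norm z)\<^sup>2))"
| "stereo Infty = (0, 1)"

lemma snd_stereo_Affine: "snd (stereo (Affine z)) = 1 - 2 / (1 + (norm z)\<^sup>2)"
proof -
  have "1 + (norm z)\<^sup>2 \<noteq> 0" by (smt (verit) zero_le_power2)
  then show ?thesis by (simp add: field_simps)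
qed

lemma inj_stereo: "inj stereo"
proof (rule injI)
  fix x y assume eq: "stereo x = stereo y"
  have pos: "1 + (norm z)\<^sup>2 > 0" for z :: complex by (smt (verit) zero_le_power2)
  have less: "snd (stereo (Affine z)) < 1" for z
    unfolding snd_stereo_Affine using pos[of z] by simp
  show "x = y"
  proof (cases x; cases y)
    fix z w assume x: "x = Affine z" and y: "y = Affine w"
    have "2 / (1 + (norm z)\<^sup>2) = 2 / (1 + (norm w)\<^sup>2)"
      using arg_cong[OF eq, of snd] unfolding x y snd_stereo_Affine by simp
    then have n: "1 + (norm z)\<^sup>2 = 1 + (norm w)\<^sup>2"
      using pos[of z] pos[of w] by (simp add: field_simps)
    have "2 * z / of_real (1 + (norm z)\<^sup>2) = 2 * w / of_real (1 + (norm w)\<^sup>2)"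
      using arg_cong[OF eq, of fst] unfolding x y stereo.simps fst_conv .
    then have "2 * z = 2 * w"
      unfolding n using pos[of w] by (metis divide_cancel_right less_irrefl of_real_eq_0_iff)
    then show "x = y" using x y by simp
  next
    fix z assume "x = Affine z" "y = Infty"
    then show "x = y" using eq less[of z] by simp
  next
    fix z assume "x = Infty" "y = Affine z"
    then show "x = y" using eq[symmetric] less[of z] by simp
  qed simp
qed

instantiation rsphere :: metric_space
begin

definition dist_rsphere :: "rsphere \<Rightarrow> rsphere \<Rightarrow> real" where
  "dist_rsphere x y = dist (stereo x) (stereo y)"

definition uniformity_rsphere :: "(rsphere \<times> rsphere) filter" where
  "uniformity_rsphere = (INF e\<in>{0<..}. principal {(x, y). dist x y < e})"

definition open_rsphere :: "rsphere set \<Rightarrow> bool" where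
  "open_rsphere U \<longleftrightarrow> (\<forall>x\<in>U. \<forall>\<^sub>F (x', y) in uniformity. x' = x \<longrightarrow> y \<in> U)"

instance
proof
  fix x y z :: rsphere
  show "(dist x y = 0) = (x = y)"
    using inj_stereo by (auto simp: dist_rsphere_def inj_eq)
  show "dist x y \<le> dist x z + dist y z"
    unfolding dist_rsphere_def by (rule dist_triangle2)
qed (rule uniformity_rsphere_def open_rsphere_def)+

end

section \<open>The group $\mathrm{PSL}_2(\mathbb{C})$ and its action on the sphere\<close>

definition SL2C :: "(complex^2^2) monoid" where
  "SL2C = \<lparr>carrier = {A. det A = 1}, mult = (**), one = mat 1\<rparr>"

definition PSL2C :: "(complex^2^2) set monoid" where
  "PSL2C = SL2C Mod {mat 1, - mat 1}"

primrec mobius_map :: "complex^2^2 \<Rightarrow> rsphere \<Rightarrow> rsphere" where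
  "mobius_map A (Affine z) =
     (if A$2$1 * z + A$2$2 = 0 then Infty
      else Affine (moebius (A$1$1) (A$1$2) (A$2$1) (A$2$2) z))"
| "mobius_map A Infty = (if A$2$1 = 0 then Infty else Affine (A$1$1 / A$2$1))"

text \<open>An element of \<^const>\<open>PSL2C\<close> is a coset \<open>{A, - A}\<close>, and both representatives induce the
  same map (see \<open>psl_act_coset\<close> below).\<close>

definition psl_act :: "(complex^2^2) set \<Rightarrow> rsphere \<Rightarrow> rsphere" where
  "psl_act g = the_elem (mobius_map ` g)"

lemma group_SL2C: "group SL2C"
proof (rule groupI)
  fix A assume "A \<in> carrier SL2C"
  then have A: "det A = 1" by (simp add: SL2C_def)
  then obtain B where B: "B ** A = mat 1"
    using invertible_det_nz[of A] invertible_left_inverse[of A] by auto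
  then have "det B = 1"
    using A det_mul[of B A] by simp
  then show "\<exists>B\<in>carrier SL2C. B \<otimes>\<^bsub>SL2C\<^esub> A = \<one>\<^bsub>SL2C\<^esub>"
    using B by (auto simp: SL2C_def)
qed (auto simp: SL2C_def det_mul matrix_mul_assoc)

lemma uminus_matrix_mult:
  fixes A B :: "'a::comm_ring_1^'n^'n"
  shows "(- A) ** B = - (A ** B)" and "A ** (- B) = - (A ** B)"
  by (simp_all add: matrix_matrix_mult_def vec_eq_iff sum_negf)

lemma normal_SL2C: "{mat 1, - mat 1} \<lhd> SL2C"
proof -
  interpret group SL2C by (rule group_SL2C)
  have sub: "{mat 1, - mat 1} \<subseteq> carrier SL2C"
    by (auto simp: SL2C_def det_2 mat_def)
  have "subgroup {mat 1, - mat 1} SL2C"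
  proof (rule subgroupI[OF sub])
    fix A :: "complex^2^2" assume A: "A \<in> {mat 1, - mat 1}"
    have "inv\<^bsub>SL2C\<^esub> A = A"
      by (rule inv_equality) (use A sub in \<open>auto simp: SL2C_def uminus_matrix_mult\<close>)
    then show "inv\<^bsub>SL2C\<^esub> A \<in> {mat 1, - mat 1}" using A by simp
  qed (auto simp: SL2C_def uminus_matrix_mult)
  then show ?thesis
    unfolding normal_inv_iff
  proof (intro conjI ballI)
    fix A N :: "complex^2^2" assume A: "A \<in> carrier SL2C" and N: "N \<in> {mat 1, - mat 1}"
    have "A \<otimes>\<^bsub>SL2C\<^esub> N = N \<otimes>\<^bsub>SL2C\<^esub> A"
      using N by (auto simp: SL2C_def uminus_matrix_mult)
    then have "A \<otimes>\<^bsub>SL2C\<^esub> N \<otimes>\<^bsub>SL2C\<^esub> inv\<^bsub>SL2C\<^esub> A = N \<otimes>\<^bsub>SL2C\<^esub> (A \<otimes>\<^bsub>SL2C\<^esub> inv\<^bsub>SL2C\<^esub> A)"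
      using A N sub m_assoc[of N A "inv\<^bsub>SL2C\<^esub> A"] inv_closed[OF A] by auto
    also have "\<dots> = N"
      unfolding r_inv[OF A] by (rule r_one) (use N sub in blast)
    finally have "A \<otimes>\<^bsub>SL2C\<^esub> N \<otimes>\<^bsub>SL2C\<^esub> inv\<^bsub>SL2C\<^esub> A = N" .
    then show "A \<otimes>\<^bsub>SL2C\<^esub> N \<otimes>\<^bsub>SL2C\<^esub> inv\<^bsub>SL2C\<^esub> A \<in> {mat 1, - mat 1}" using N by simp
  qed
qed

lemma group_PSL2C: "group PSL2C"
  unfolding PSL2C_def by (rule normal.factorgroup_is_group[OF normal_SL2C])

lemma SL2C_coset: "{mat 1, - mat 1} #>\<^bsub>SL2C\<^esub> A = {A, - A}"
  by (auto simp: r_coset_def SL2C_def uminus_matrix_mult)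

lemma mobius_map_uminus: "mobius_map (- A) = mobius_map A"
proof
  fix x show "mobius_map (- A) x = mobius_map A x"
  proof (cases x)
    case (Affine z)
    have d: "(- A$2$1) * z + (- A$2$2) = - (A$2$1 * z + A$2$2)"
      and n: "(- A$1$1) * z + (- A$1$2) = - (A$1$1 * z + A$1$2)" by (simp_all add: algebra_simps)
    show ?thesis
      unfolding Affine mobius_map.simps moebius_def vector_uminus_component d n
      by (simp only: neg_equal_0_iff_equal minus_divide_left[symmetric] minus_divide_right[symmetric] minus_minus)
  qed simp
qed

lemma psl_act_coset: "psl_act ({mat 1, - mat 1} #>\<^bsub>SL2C\<^esub> A) = mobius_map A"
  by (simp add: psl_act_def SL2C_coset mobius_map_uminus)

section \<open>Non-empty compact sets and the Hausdorff distance\<close>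

definition compacts :: "'a::metric_space set set" where
  "compacts = {A. compact A \<and> A \<noteq> {}}"

text \<open>The value \<open>0\<close> outside \<^const>\<open>compacts\<close> is a convention: the locale
  \<^locale>\<open>Metric_space\<close> asks for non-negativity and symmetry of the distance without
  restriction to the carrier.\<close>

definition hausdist :: "'a::metric_space set \<Rightarrow> 'a set \<Rightarrow> real" where
  "hausdist A B =
     (if A \<in> compacts \<and> B \<in> compacts
      then max (SUP a\<in>A. infdist a B) (SUP b\<in>B. infdist b A) else 0)"

lemma bdd_above_infdist:
  assumes "compact A" shows "bdd_above ((\<lambda>a. infdist a B) ` A)"
  by (intro bounded_imp_bdd_above compact_imp_bounded compact_continuous_image assms
        continuous_intros)

lemma hausdist_commute: "hausdist A B = hausdist B A"
  by (simp add: hausdist_def max.commute conj_commute)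

lemma infdist_le_hausdist:
  assumes "A \<in> compacts" "B \<in> compacts" "a \<in> A" shows "infdist a B \<le> hausdist A B"
  using assms cSUP_upper[OF assms(3) bdd_above_infdist[of A B]]
  by (auto simp: hausdist_def compacts_def)

lemma hausdist_le:
  assumes "A \<in> compacts" "B \<in> compacts"
    and "\<And>a. a \<in> A \<Longrightarrow> infdist a B \<le> e" "\<And>b. b \<in> B \<Longrightarrow> infdist b A \<le> e"
  shows "hausdist A B \<le> e"
  unfolding hausdist_def using assms by (auto simp: compacts_def intro!: cSUP_least)

interpretation hausdorff: Metric_space "compacts :: 'a::metric_space set set" hausdist
proof
  fix A B :: "'a set"
  show "0 \<le> hausdist A B"
  proof (cases "A \<in> compacts \<and> B \<in> compacts")
    case True
    then obtain a where "a \<in> A" by (auto simp: compacts_def)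
    then show ?thesis
      using True infdist_le_hausdist[of A B a] infdist_nonneg[of a B] by simp
  qed (auto simp: hausdist_def)
  show "hausdist A B = hausdist B A" by (rule hausdist_commute)
next
  fix A B :: "'a set" assume AB: "A \<in> compacts" "B \<in> compacts"
  have sub: "A \<subseteq> B" if "hausdist A B = 0" "A \<in> compacts" "B \<in> compacts" for A B :: "'a set"
  proof
    fix a assume "a \<in> A"
    then have "infdist a B = 0"
      using infdist_le_hausdist[of A B a] infdist_nonneg[of a B] that by simp
    then show "a \<in> B"
      using that in_closed_iff_infdist_zero[of B a] by (auto simp: compacts_def compact_imp_closed)
  qed
  show "hausdist A B = 0 \<longleftrightarrow> A = B"
  proof
    assume "hausdist A B = 0"
    then show "A = B" using sub[of A B] sub[of B A] AB by (simp add: hausdist_commute)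
  next
    assume "A = B"
    then show "hausdist A B = 0" using AB by (auto simp: hausdist_def compacts_def)
  qed
next
  fix A B C :: "'a set" assume ABC: "A \<in> compacts" "B \<in> compacts" "C \<in> compacts"
  have tri: "infdist a C \<le> hausdist A B + hausdist B C"
    if "a \<in> A" "A \<in> compacts" "B \<in> compacts" "C \<in> compacts" for a and A B C :: "'a set"
  proof -
    have "compact B" "B \<noteq> {}" using that by (auto simp: compacts_def)
    moreover have "continuous_on B (\<lambda>y. dist a y)" by (intro continuous_intros)
    ultimately obtain b where "b \<in> B" and le: "\<forall>y\<in>B. dist a b \<le> dist a y"
      using continuous_attains_inf by blast
    moreover have "dist a b \<le> infdist a B"
      using le \<open>B \<noteq> {}\<close> by (auto simp: infdist_notempty intro!: cINF_greatest)
    ultimately show ?thesis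
      using infdist_triangle[of a C b] infdist_le_hausdist[of B C b]
        infdist_le_hausdist[of A B a] that by simp
  qed
  show "hausdist A C \<le> hausdist A B + hausdist B C"
    using ABC tri[of _ A B C] tri[of _ C B A]
    by (intro hausdist_le) (simp_all add: hausdist_commute add.commute)
qed

text \<open>The space $\mathcal{K}_0$, topologised as a subspace of $\mathcal{K}$.\<close>

definition nonsingleton_compacts :: "rsphere set set" where
  "nonsingleton_compacts = {A \<in> compacts. \<not> is_singleton A}"

definition K0_topology :: "rsphere set topology" where
  "K0_topology = subtopology hausdorff.mtopology nonsingleton_compacts"

section \<open>Quasiconformal maps\<close>

text \<open>For complex-valued functions on a compact interval.\<close>

definition absolutely_continuous_on :: "real set \<Rightarrow> (real \<Rightarrow> complex) \<Rightarrow> bool" where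
  "absolutely_continuous_on S f \<longleftrightarrow>
     (\<forall>e>0. \<exists>d>0. \<forall>D T. D division_of T \<and> T \<subseteq> S \<and> (\<Sum>I\<in>D. Sup I - Inf I) < d \<longrightarrow>
        (\<Sum>I\<in>D. dist (f (Sup I)) (f (Inf I))) < e)"

definition ACL :: "complex set \<Rightarrow> (complex \<Rightarrow> complex) \<Rightarrow> bool" where
  "ACL U f \<longleftrightarrow> continuous_on U f \<and>
     (\<forall>a b. cbox a b \<subseteq> U \<longrightarrow>
        (AE y in lborel. y \<in> {Im a..Im b} \<longrightarrow>
           absolutely_continuous_on {Re a..Re b} (\<lambda>x. f (Complex x y))) \<and>
        (AE x in lborel. x \<in> {Re a..Re b} \<longrightarrow>
           absolutely_continuous_on {Im a..Im b} (\<lambda>y. f (Complex x y))))"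

text \<open>Below \<open>p\<close> and \<open>q\<close> are the partial derivatives \<open>f\<^sub>x\<close> and \<open>f\<^sub>y\<close>, so that
  \<open>(p + \<i> * q) / 2\<close> and \<open>(p - \<i> * q) / 2\<close> are the Wirtinger derivatives of \<open>f\<close> with
  respect to the conjugate of \<open>z\<close> and to \<open>z\<close>.\<close>

definition beltrami_bound :: "real \<Rightarrow> complex set \<Rightarrow> (complex \<Rightarrow> complex) \<Rightarrow> bool" where
  "beltrami_bound K U f \<longleftrightarrow>
     (AE z in lborel. z \<in> U \<longrightarrow>
        (\<exists>p q. ((\<lambda>t. f (z + of_real t)) has_vector_derivative p) (at 0) \<and>
               ((\<lambda>t. f (z + \<i> * of_real t)) has_vector_derivative q) (at 0) \<and>
               norm ((p + \<i> * q) / 2) \<le> (K - 1) / (K + 1) * norm ((p - \<i> * q) / 2)))"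

text \<open>For injective continuous \<open>f\<close> on an open set; the winding number is then \<open>1\<close> or \<open>- 1\<close>.\<close>

definition orientation_preserving :: "complex set \<Rightarrow> (complex \<Rightarrow> complex) \<Rightarrow> bool" where
  "orientation_preserving U f \<longleftrightarrow>
     (\<forall>z r. r > 0 \<and> cball z r \<subseteq> U \<longrightarrow> winding_number (f \<circ> circlepath z r) (f z) = 1)"

text \<open>The sphere has the two charts \<open>coord \<circ> \<sigma>\<close> with \<open>\<sigma> \<in> {id, rinverse}\<close>, whose inverses
  are \<open>\<sigma> \<circ> Affine\<close>. All conditions on a map between domains of the sphere are imposed on each of
  its expressions in these charts.\<close>

primrec rinverse :: "rsphere \<Rightarrow> rsphere" where
  "rinverse (Affine z) = (if z = 0 then Infty else Affine (inverse z))"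
| "rinverse Infty = Affine 0"

definition domain_rsphere :: "rsphere set \<Rightarrow> bool" where
  "domain_rsphere D \<longleftrightarrow> open D \<and> connected D \<and> D \<noteq> {}"

definition quasiconformal :: "real \<Rightarrow> rsphere set \<Rightarrow> rsphere set \<Rightarrow> (rsphere \<Rightarrow> rsphere) \<Rightarrow> bool"
  where "quasiconformal K D E h \<longleftrightarrow>
     K \<ge> 1 \<and> domain_rsphere D \<and> domain_rsphere E \<and> (\<exists>g. homeomorphism D E h g) \<and>
     (\<forall>\<sigma>\<in>{id, rinverse}. \<forall>\<tau>\<in>{id, rinverse}.
        let f = coord \<circ> \<tau> \<circ> h \<circ> \<sigma> \<circ> Affine;
            U = {z. \<sigma> (Affine z) \<in> D \<and> \<tau> (h (\<sigma> (Affine z))) \<noteq> Infty}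
        in orientation_preserving U f \<and> ACL U f \<and> beltrami_bound K U f)"

section \<open>Jordan curves, quasicircles and the Benoist--Hulin condition\<close>

definition jordan_curve :: "rsphere set \<Rightarrow> bool" where
  "jordan_curve A \<longleftrightarrow>
     (\<exists>f. continuous_on (sphere (0::complex) 1) f \<and> inj_on f (sphere 0 1) \<and> A = f ` sphere 0 1)"

definition round_circle :: "rsphere set \<Rightarrow> bool" where
  "round_circle A \<longleftrightarrow>
     (\<exists>c r. r > 0 \<and> A = Affine ` sphere c r) \<or>
     (\<exists>a v. v \<noteq> 0 \<and> A = insert Infty (range (\<lambda>t. Affine (a + of_real t * v))))"

definition quasicircle :: "real \<Rightarrow> rsphere set \<Rightarrow> bool" where
  "quasicircle K A \<longleftrightarrow>
     jordan_curve A \<and> (\<exists>h B. quasiconformal K UNIV UNIV h \<and> round_circle B \<and> A = h ` B)"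

definition BH_condition :: "(complex^2^2) set set \<Rightarrow> bool" where
  "BH_condition \<Gamma> \<longleftrightarrow>
     (\<forall>\<C>. closedin K0_topology \<C> \<and> (\<forall>g\<in>\<Gamma>. \<forall>A\<in>\<C>. psl_act g ` A \<in> \<C>) \<and> (\<forall>A\<in>\<C>. jordan_curve A)
        \<longrightarrow> (\<exists>K\<ge>1. \<forall>A\<in>\<C>. quasicircle K A))"

end

theory Submission
  imports Defs
begin

text \<open>
  A larger group has fewer invariant families of curves, so the condition passes from
  \<open>\<Gamma>\<^sub>0\<close> to \<open>\<Gamma>\<close> at once. For the converse, a closed \<open>\<Gamma>\<^sub>0\<close>-invariant family \<open>\<C>\<close> of Jordan
  curves is enlarged to its \<open>\<Gamma>\<close>-saturation \<open>\<D>\<close>, the union of the families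
  \<open>{A. g A \<in> \<C>}\<close> over \<open>g \<in> \<Gamma>\<close>. Since \<open>\<C>\<close> is \<open>\<Gamma>\<^sub>0\<close>-invariant, such a family depends only on the
  coset of \<open>g\<close> modulo \<open>\<Gamma>\<^sub>0\<close>; finite index therefore makes the union finite, and \<open>\<D>\<close> is closed.
  A constant \<open>K\<close> that serves \<open>\<D>\<close> serves its subfamily \<open>\<C>\<close>.

  What needs proof is that a Moebius transformation acts continuously on the space of compact
  sets (\<open>continuous_map_psl_act\<close>), so that these families are closed. In homogeneous
  coordinates the chordal distance is \<open>2 * \<bar>p \<and> q\<bar> / (\<bar>p\<bar> * \<bar>q\<bar>)\<close> (\<open>dist_proj_point\<close>), where
  \<open>p \<and> q\<close> is the determinant of the two vectors. A matrix of determinant one preserves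
  \<open>p \<and> q\<close> and changes the norms by bounded factors, so it acts by a Lipschitz map
  (\<open>mobius_map_lipschitz\<close>), and Lipschitz maps with compact images act on compact sets with the
  same constant for the Hausdorff distance (\<open>hausdist_image_le\<close>).
\<close>

section \<open>Homogeneous coordinates on the sphere\<close>

definition proj_point :: "complex^2 \<Rightarrow> rsphere" where
  "proj_point p = (if p$2 = 0 then Infty else Affine (p$1 / p$2))"

primrec homog :: "rsphere \<Rightarrow> complex^2" where
  "homog (Affine z) = vector [z, 1]"
| "homog Infty = vector [1, 0]"

lemma proj_point_homog: "proj_point (homog x) = x"
  by (cases x) (simp_all add: proj_point_def)

lemma homog_nonzero: "homog x \<noteq> 0"
  by (cases x) (auto simp: vec_eq_iff forall_2)

lemma norm_complex2_power2: "(norm (p :: complex^2))\<^sup>2 = (cmod (p$1))\<^sup>2 + (cmod (p$2))\<^sup>2"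
  by (simp add: norm_vec_def L2_set_def sum_2)

text \<open>The Hopf map: the formula clears the denominators of stereographic projection and so covers
  the point at infinity together with the affine points.\<close>

lemma stereo_proj_point:
  assumes "p \<noteq> 0"
  shows "stereo (proj_point p) =
    (1 / (norm p)\<^sup>2) *\<^sub>R (2 * p$1 * cnj (p$2), (cmod (p$1))\<^sup>2 - (cmod (p$2))\<^sup>2)"
proof (cases "p$2 = 0")
  case True
  then have "p$1 \<noteq> 0" using assms by (auto simp: vec_eq_iff forall_2)
  then show ?thesis using True by (simp add: proj_point_def norm_complex2_power2)
next
  case False
  define n where "n = (norm p)\<^sup>2"
  have n: "n = (cmod (p$1))\<^sup>2 + (cmod (p$2))\<^sup>2" unfolding n_def by (rule norm_complex2_power2)
  have b: "(cmod (p$2))\<^sup>2 \<noteq> 0" using False by simp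
  have n0: "n \<noteq> 0" using assms by (simp add: n_def)
  have den: "1 + (cmod (p$1 / p$2))\<^sup>2 = n / (cmod (p$2))\<^sup>2"
    using b by (simp add: n norm_divide power_divide field_simps)
  have "2 * (p$1 / p$2) / complex_of_real (n / (cmod (p$2))\<^sup>2)
      = (1 / n) *\<^sub>R (2 * p$1 * cnj (p$2))"
    using False n0 complex_norm_square[of "p$2"]
    by (simp add: scaleR_conv_of_real field_simps power2_eq_square)
  moreover have "((cmod (p$1 / p$2))\<^sup>2 - 1) / (n / (cmod (p$2))\<^sup>2)
      = (1 / n) * ((cmod (p$1))\<^sup>2 - (cmod (p$2))\<^sup>2)"
    using b n0 by (simp add: norm_divide power_divide field_simps)
  ultimately show ?thesis
    using False unfolding proj_point_def n_def[symmetric] by (simp add: den)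
qed

text \<open>Both points lie on the unit sphere, so the squared distance is twice one minus the inner
  product of their images; Lagrange's identity turns this into the squared determinant.\<close>

lemma dist_proj_point:
  assumes p: "p \<noteq> 0" and q: "q \<noteq> 0"
  shows "dist (proj_point p) (proj_point q) = 2 * cmod (p$1 * q$2 - p$2 * q$1) / (norm p * norm q)"
proof -
  define v where "v p = (2 * p$1 * cnj (p$2), (cmod (p$1))\<^sup>2 - (cmod (p$2))\<^sup>2)" for p :: "complex^2"
  define m n where "m = (norm p)\<^sup>2" and "n = (norm q)\<^sup>2"
  have m0: "m > 0" and n0: "n > 0" using p q by (simp_all add: m_def n_def)
  have unit: "v r \<bullet> v r = ((norm r)\<^sup>2)\<^sup>2" for r
    unfolding v_def norm_complex2_power2 cmod_power2
    by (simp add: inner_complex_def algebra_simps power2_eq_square)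
  have cross: "m * n - v p \<bullet> v q = 2 * (cmod (p$1 * q$2 - p$2 * q$1))\<^sup>2"
    unfolding v_def m_def n_def norm_complex2_power2 cmod_power2
    by (simp add: inner_complex_def algebra_simps power2_eq_square)
  have "(dist (proj_point p) (proj_point q))\<^sup>2 = (norm ((1/m) *\<^sub>R v p - (1/n) *\<^sub>R v q))\<^sup>2"
    using stereo_proj_point[OF p] stereo_proj_point[OF q]
    by (simp add: dist_rsphere_def dist_norm v_def m_def n_def)
  also have "\<dots> = (1/m)\<^sup>2 * (v p \<bullet> v p) - 2 * (1/m) * (1/n) * (v p \<bullet> v q) + (1/n)\<^sup>2 * (v q \<bullet> v q)"
    unfolding power2_norm_eq_inner by (simp add: inner_diff inner_commute power2_eq_square)
  also have "\<dots> = 2 * (m * n - v p \<bullet> v q) / (m * n)"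
    using m0 n0 unfolding unit m_def[symmetric] n_def[symmetric]
    by (simp add: field_simps power2_eq_square)
  also have "\<dots> = (2 * cmod (p$1 * q$2 - p$2 * q$1) / (norm p * norm q))\<^sup>2"
    unfolding cross by (simp add: m_def n_def power_mult_distrib power_divide)
  finally show ?thesis
    by (rule power2_eq_imp_eq) simp_all
qed

section \<open>Moebius transformations are Lipschitz\<close>

text \<open>Fractional linear maps become linear in homogeneous coordinates. Hence no later proof has to
  treat poles or the point at infinity separately.\<close>

lemma mobius_map_proj_point:
  assumes "p \<noteq> 0"
  shows "mobius_map A (proj_point p) = proj_point (A *v p)"
proof (cases "p$2 = 0")
  case True
  then have "p$1 \<noteq> 0" using assms by (auto simp: vec_eq_iff forall_2)
  then show ?thesis
    using True by (simp add: proj_point_def matrix_vector_mult_def sum_2)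
next
  case False
  have "A$2$1 * (p$1 / p$2) + A$2$2 = (A$2$1 * p$1 + A$2$2 * p$2) / p$2"
    and "A$1$1 * (p$1 / p$2) + A$1$2 = (A$1$1 * p$1 + A$1$2 * p$2) / p$2"
    using False by (simp_all add: field_simps)
  then show ?thesis
    using False by (simp add: proj_point_def matrix_vector_mult_def sum_2 moebius_def)
qed

lemma mobius_map_eq: "mobius_map A x = proj_point (A *v homog x)"
  using mobius_map_proj_point[OF homog_nonzero, of A x] by (simp add: proj_point_homog)

lemma det_nonzero_mult_nonzero:
  fixes A :: "'a::field^'n^'n"
  assumes "det A \<noteq> 0" "p \<noteq> 0" shows "A *v p \<noteq> 0"
  using assms invertible_det_nz[of A] invertible_left_inverse[of A]
  by (metis matrix_left_invertible_ker)

lemma mobius_map_mult: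
  assumes "det B \<noteq> 0"
  shows "mobius_map (A ** B) = mobius_map A \<circ> mobius_map B"
  using det_nonzero_mult_nonzero[OF assms homog_nonzero]
  by (auto simp: fun_eq_iff mobius_map_eq[of "A ** B"] mobius_map_eq[of B] mobius_map_proj_point
      matrix_vector_mul_assoc)

lemma mobius_map_mat_1: "mobius_map (mat 1) = id"
  by (simp add: fun_eq_iff mobius_map_eq proj_point_homog)

lemma wedge_matrix_vector_mult:
  fixes A :: "'a::comm_ring_1^2^2"
  shows "(A *v p)$1 * (A *v q)$2 - (A *v p)$2 * (A *v q)$1 = det A * (p$1 * q$2 - p$2 * q$1)"
  by (simp add: matrix_vector_mult_def sum_2 det_2 algebra_simps)

lemma bounded_linear_matrix_vector_mult: "bounded_linear ((*v) (B :: complex^2^2))"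
  by (intro linear_conv_bounded_linear[THEN iffD1] linearI)
     (simp_all add: vec_eq_iff matrix_vector_mult_def sum_2 algebra_simps)

text \<open>By \<open>wedge_matrix_vector_mult\<close>, the numerator of the chordal distance is unchanged by a matrix of
  determinant one; the inverse matrix bounds each factor of the denominator from below.\<close>

lemma mobius_map_lipschitz:
  assumes A: "det A = 1"
  shows "\<exists>L>0. \<forall>x y. dist (mobius_map A x) (mobius_map A y) \<le> L * dist x y"
proof -
  obtain B where B: "B ** A = mat 1"
    using A invertible_det_nz[of A] invertible_left_inverse[of A] by auto
  obtain b where b: "b > 0" "\<And>p. norm (B *v p) \<le> norm p * b"
    using bounded_linear.pos_bounded[OF bounded_linear_matrix_vector_mult] by blast
  have lower: "norm p \<le> norm (A *v p) * b" for p
    using b(2)[of "A *v p"] B by (simp add: matrix_vector_mul_assoc)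
  have "dist (mobius_map A x) (mobius_map A y) \<le> b\<^sup>2 * dist x y" for x y
  proof -
    define p q where "p = homog x" and "q = homog y"
    have pq: "p \<noteq> 0" "q \<noteq> 0" by (simp_all add: p_def q_def homog_nonzero)
    then have Apq: "A *v p \<noteq> 0" "A *v q \<noteq> 0"
      using A by (simp_all add: det_nonzero_mult_nonzero)
    define w where "w = 2 * cmod (p$1 * q$2 - p$2 * q$1)"
    have "dist (mobius_map A x) (mobius_map A y) = w / (norm (A *v p) * norm (A *v q))"
      using A dist_proj_point[OF Apq] wedge_matrix_vector_mult[of A p q]
      by (simp add: mobius_map_eq p_def q_def w_def)
    also have "\<dots> \<le> b\<^sup>2 * (w / (norm p * norm q))"
    proof -
      have "norm p * norm q \<le> (norm (A *v p) * b) * (norm (A *v q) * b)"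
        by (intro mult_mono lower) (use b in auto)
      then have "w * (norm p * norm q) \<le> w * ((norm (A *v p) * b) * (norm (A *v q) * b))"
        by (rule mult_left_mono) (simp add: w_def)
      then show ?thesis
        using pq Apq by (simp add: divide_simps power2_eq_square mult_ac)
    qed
    also have "w / (norm p * norm q) = dist x y"
      using dist_proj_point[OF pq] by (simp add: w_def p_def q_def proj_point_homog)
    finally show ?thesis .
  qed
  then show ?thesis using b(1) by (intro exI[of _ "b\<^sup>2"]) simp
qed

section \<open>The action on the sphere\<close>

lemma carrier_PSL2C_cases:
  assumes "g \<in> carrier PSL2C"
  obtains A where "det A = 1" "g = {mat 1, - mat 1} #>\<^bsub>SL2C\<^esub> A"
  using assms by (auto simp: PSL2C_def FactGroup_def RCOSETS_def SL2C_def)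

lemma psl_act_mult:
  assumes "g \<in> carrier PSL2C" "h \<in> carrier PSL2C"
  shows "psl_act (g \<otimes>\<^bsub>PSL2C\<^esub> h) = psl_act g \<circ> psl_act h"
proof -
  obtain A B where A: "det A = 1" "g = {mat 1, - mat 1} #>\<^bsub>SL2C\<^esub> A"
    and B: "det B = 1" "h = {mat 1, - mat 1} #>\<^bsub>SL2C\<^esub> B"
    using assms by (metis carrier_PSL2C_cases)
  have "g \<otimes>\<^bsub>PSL2C\<^esub> h = {mat 1, - mat 1} #>\<^bsub>SL2C\<^esub> (A ** B)"
    using normal.rcos_sum[OF normal_SL2C, of A B] A B
    by (simp add: PSL2C_def FactGroup_def SL2C_def)
  then show ?thesis using A B by (simp add: psl_act_coset mobius_map_mult)
qed

lemma psl_act_one: "psl_act \<one>\<^bsub>PSL2C\<^esub> = id"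
  by (simp add: PSL2C_def FactGroup_def psl_act_def mobius_map_uminus mobius_map_mat_1)

lemma psl_act_inv:
  assumes "g \<in> carrier PSL2C"
  shows "psl_act (inv\<^bsub>PSL2C\<^esub> g) (psl_act g x) = x"
proof -
  interpret group PSL2C by (rule group_PSL2C)
  show ?thesis
    using psl_act_mult[of "inv\<^bsub>PSL2C\<^esub> g" g] assms by (simp add: psl_act_one fun_eq_iff)
qed

lemma inj_psl_act: "g \<in> carrier PSL2C \<Longrightarrow> inj (psl_act g)"
  using psl_act_inv by (metis injI)

lemma psl_act_lipschitz:
  assumes "g \<in> carrier PSL2C"
  shows "\<exists>L>0. \<forall>x y. dist (psl_act g x) (psl_act g y) \<le> L * dist x y"
  using assms by (metis carrier_PSL2C_cases psl_act_coset mobius_map_lipschitz)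

lemma continuous_on_psl_act:
  assumes "g \<in> carrier PSL2C"
  shows "continuous_on S (psl_act g)"
proof -
  obtain L where "L > 0" "\<And>x y. dist (psl_act g x) (psl_act g y) \<le> L * dist x y"
    using psl_act_lipschitz[OF assms] by blast
  then have "L-lipschitz_on S (psl_act g)" by (intro lipschitz_onI) auto
  then show ?thesis by (rule lipschitz_on_continuous_on)
qed

section \<open>The action on compact sets\<close>

lemma hausdist_image_le:
  fixes f :: "'a::metric_space \<Rightarrow> 'b::metric_space"
  assumes L: "L > 0" "\<And>x y. dist (f x) (f y) \<le> L * dist x y"
    and AB: "A \<in> compacts" "B \<in> compacts" and fAB: "f ` A \<in> compacts" "f ` B \<in> compacts"
  shows "hausdist (f ` A) (f ` B) \<le> L * hausdist A B"
proof -
  have half: "infdist (f a) (f ` B) \<le> L * hausdist A B"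
    if "a \<in> A" "A \<in> compacts" "B \<in> compacts" for a and A B :: "'a set"
  proof -
    have "infdist (f a) (f ` B) / L \<le> dist a b" if "b \<in> B" for b
      using that L(1) L(2)[of a b] infdist_le[of "f b" "f ` B" "f a"]
      by (simp add: divide_le_eq mult.commute)
    moreover have "B \<noteq> {}" using \<open>B \<in> compacts\<close> by (simp add: compacts_def)
    ultimately have "infdist (f a) (f ` B) / L \<le> infdist a B"
      unfolding infdist_notempty[OF \<open>B \<noteq> {}\<close>] by (intro cINF_greatest)
    also have "\<dots> \<le> hausdist A B" using that by (intro infdist_le_hausdist)
    finally show ?thesis using L by (simp add: field_simps)
  qed
  show ?thesis
    using half[of _ A B] half[of _ B A] AB fAB
    by (intro hausdist_le) (auto simp: hausdist_commute)
qed

lemma psl_act_nonsingleton_compacts: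
  assumes "g \<in> carrier PSL2C" "A \<in> nonsingleton_compacts"
  shows "psl_act g ` A \<in> nonsingleton_compacts"
  using assms inj_psl_act[OF assms(1)]
    compact_continuous_image[OF continuous_on_psl_act[OF assms(1)], of A]
  by (auto simp: nonsingleton_compacts_def compacts_def is_singleton_altdef card_image inj_on_subset)

lemma topspace_K0_topology: "topspace K0_topology = nonsingleton_compacts"
  by (auto simp: K0_topology_def nonsingleton_compacts_def)

lemma continuous_map_psl_act:
  assumes g: "g \<in> carrier PSL2C"
  shows "continuous_map K0_topology K0_topology ((`) (psl_act g))"
proof -
  obtain L where L: "L > 0" "\<And>x y. dist (psl_act g x) (psl_act g y) \<le> L * dist x y"
    using psl_act_lipschitz[OF g] by blast
  have comp: "psl_act g ` A \<in> compacts" if "A \<in> compacts" for A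
    using that compact_continuous_image[OF continuous_on_psl_act[OF g], of A]
    by (auto simp: compacts_def)
  have "continuous_map hausdorff.mtopology hausdorff.mtopology ((`) (psl_act g))"
    unfolding hausdorff.metric_continuous_map[OF hausdorff.Metric_space_axioms]
  proof (intro conjI ballI allI impI)
    fix A :: "rsphere set" and e :: real assume A: "A \<in> compacts" and e: "e > 0"
    show "\<exists>d>0. \<forall>B. B \<in> compacts \<and> hausdist A B < d \<longrightarrow> hausdist (psl_act g ` A) (psl_act g ` B) < e"
    proof (intro exI[of _ "e / L"] conjI allI impI)
      fix B :: "rsphere set" assume B: "B \<in> compacts \<and> hausdist A B < e / L"
      have "hausdist (psl_act g ` A) (psl_act g ` B) \<le> L * hausdist A B"
        using L A B comp by (intro hausdist_image_le) auto
      also have "\<dots> < e" using B L by (simp add: field_simps)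
      finally show "hausdist (psl_act g ` A) (psl_act g ` B) < e" .
    qed (use e L in simp)
  qed (use comp in auto)
  then show ?thesis
    using psl_act_nonsingleton_compacts[OF g] unfolding K0_topology_def
    by (intro continuous_map_into_subtopology continuous_map_from_subtopology) auto
qed

lemma jordan_curve_psl_act:
  assumes g: "g \<in> carrier PSL2C" and A: "jordan_curve A"
  shows "jordan_curve (psl_act g ` A)"
proof -
  obtain f where f: "continuous_on (sphere (0::complex) 1) f" "inj_on f (sphere 0 1)"
    and A: "A = f ` sphere 0 1"
    using A by (auto simp: jordan_curve_def)
  have "continuous_on (sphere 0 1) (psl_act g \<circ> f)"
    by (intro continuous_on_compose f continuous_on_psl_act g)
  moreover have "inj_on (psl_act g \<circ> f) (sphere 0 1)"
    using f(2) inj_psl_act[OF g] by (intro comp_inj_on) (auto intro: inj_on_subset)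
  ultimately show ?thesis
    unfolding jordan_curve_def A by (intro exI[of _ "psl_act g \<circ> f"]) (simp add: image_comp)
qed

section \<open>Finite-index subgroups\<close>

lemma BH_condition_mono:
  assumes "\<Gamma>\<^sub>0 \<subseteq> \<Gamma>" "BH_condition \<Gamma>\<^sub>0"
  shows "BH_condition \<Gamma>"
  using assms unfolding BH_condition_def by blast

text \<open>The substantial direction, by saturating a \<open>\<Gamma>\<^sub>0\<close>-invariant family under \<open>\<Gamma>\<close>. The translates
  of \<open>\<C>\<close> are taken as preimages rather than images: continuity then gives closedness directly,
  and the preimages are indexed by right cosets \<open>\<Gamma>\<^sub>0 g\<close>, the cosets that are
  assumed finite in number.\<close>

lemma BH_condition_finite_index:
  assumes \<Gamma>: "subgroup \<Gamma> PSL2C" and \<Gamma>\<^sub>0: "subgroup \<Gamma>\<^sub>0 PSL2C"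
    and fin: "finite (rcosets\<^bsub>PSL2C\<lparr>carrier := \<Gamma>\<rparr>\<^esub> \<Gamma>\<^sub>0)" and BH: "BH_condition \<Gamma>"
  shows "BH_condition \<Gamma>\<^sub>0"
  unfolding BH_condition_def
proof (intro allI impI, elim conjE)
  fix \<C>
  assume closed: "closedin K0_topology \<C>" and inv: "\<forall>g\<in>\<Gamma>\<^sub>0. \<forall>A\<in>\<C>. psl_act g ` A \<in> \<C>"
    and jordan: "\<forall>A\<in>\<C>. jordan_curve A"
  interpret group PSL2C by (rule group_PSL2C)
  interpret \<Gamma>: subgroup \<Gamma> PSL2C by (rule \<Gamma>)
  interpret \<Gamma>\<^sub>0: subgroup \<Gamma>\<^sub>0 PSL2C by (rule \<Gamma>\<^sub>0)
  define pullback where "pullback g = {A \<in> nonsingleton_compacts. psl_act g ` A \<in> \<C>}" for g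
  define coset_pullback where
    "coset_pullback R = {A \<in> nonsingleton_compacts. \<forall>g\<in>R. psl_act g ` A \<in> \<C>}" for R
  define \<D> where "\<D> = (\<Union>g\<in>\<Gamma>. pullback g)"
  \<comment> \<open>Invariance of \<open>\<C>\<close> makes one representative as good as all, so a pullback is a function of the
    coset alone.\<close>
  have pullback_eq: "pullback g = coset_pullback (\<Gamma>\<^sub>0 #>\<^bsub>PSL2C\<lparr>carrier := \<Gamma>\<rparr>\<^esub> g)" if "g \<in> \<Gamma>" for g
  proof -
    have coset: "\<Gamma>\<^sub>0 #>\<^bsub>PSL2C\<lparr>carrier := \<Gamma>\<rparr>\<^esub> g = {h \<otimes>\<^bsub>PSL2C\<^esub> g |h. h \<in> \<Gamma>\<^sub>0}"
      by (auto simp: r_coset_def)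
    have "psl_act (h \<otimes>\<^bsub>PSL2C\<^esub> g) ` A \<in> \<C>" if "h \<in> \<Gamma>\<^sub>0" "psl_act g ` A \<in> \<C>" for h A
      using that inv \<open>g \<in> \<Gamma>\<close> by (simp add: psl_act_mult image_comp[symmetric] del: o_apply)
    moreover have "g \<in> \<Gamma>\<^sub>0 #>\<^bsub>PSL2C\<lparr>carrier := \<Gamma>\<rparr>\<^esub> g"
      unfolding coset using \<open>g \<in> \<Gamma>\<close> \<Gamma>\<^sub>0.one_closed l_one[of g] by (auto intro!: exI[of _ "\<one>\<^bsub>PSL2C\<^esub>"])
    ultimately show ?thesis
      unfolding pullback_def coset_pullback_def coset by auto
  qed
  have "pullback ` \<Gamma> \<subseteq> coset_pullback ` (rcosets\<^bsub>PSL2C\<lparr>carrier := \<Gamma>\<rparr>\<^esub> \<Gamma>\<^sub>0)"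
    using pullback_eq by (auto simp: RCOSETS_def)
  then have "finite (pullback ` \<Gamma>)" using fin by (meson finite_imageI finite_subset)
  moreover have "closedin K0_topology (pullback g)" if "g \<in> \<Gamma>" for g
    using closedin_continuous_map_preimage[OF continuous_map_psl_act[of g] closed] that
    by (simp add: pullback_def topspace_K0_topology)
  ultimately have "closedin K0_topology \<D>"
    unfolding \<D>_def by (intro closedin_Union) auto
  moreover have "psl_act g ` A \<in> \<D>" if "g \<in> \<Gamma>" "A \<in> \<D>" for g A
  proof -
    obtain k where k: "k \<in> \<Gamma>" "A \<in> nonsingleton_compacts" "psl_act k ` A \<in> \<C>"
      using \<open>A \<in> \<D>\<close> by (auto simp: \<D>_def pullback_def)
    \<comment> \<open>Translating by \<open>g\<close> permutes the pullbacks, \<open>k\<close> going to \<open>k g\<inverse>\<close>.\<close>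
    have "psl_act (k \<otimes>\<^bsub>PSL2C\<^esub> inv\<^bsub>PSL2C\<^esub> g) ` psl_act g ` A = psl_act k ` A"
      using that k by (simp add: psl_act_mult image_image psl_act_inv)
    then have "psl_act g ` A \<in> pullback (k \<otimes>\<^bsub>PSL2C\<^esub> inv\<^bsub>PSL2C\<^esub> g)"
      using that k by (simp add: pullback_def psl_act_nonsingleton_compacts)
    then show ?thesis unfolding \<D>_def using that k by blast
  qed
  moreover have "jordan_curve A" if "A \<in> \<D>" for A
  proof -
    obtain k where k: "k \<in> \<Gamma>" "psl_act k ` A \<in> \<C>"
      using \<open>A \<in> \<D>\<close> by (auto simp: \<D>_def pullback_def)
    then have "jordan_curve (psl_act (inv\<^bsub>PSL2C\<^esub> k) ` psl_act k ` A)"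
      using jordan by (simp add: jordan_curve_psl_act[of "inv\<^bsub>PSL2C\<^esub> k" "psl_act k ` A"])
    then show ?thesis using k by (simp add: image_image psl_act_inv)
  qed
  ultimately obtain K where "K \<ge> 1" "\<forall>A\<in>\<D>. quasicircle K A"
    using BH unfolding BH_condition_def by meson
  moreover have "\<C> \<subseteq> pullback \<one>\<^bsub>PSL2C\<^esub>"
    using closedin_subset[OF closed] by (auto simp: pullback_def psl_act_one topspace_K0_topology)
  then have "\<C> \<subseteq> \<D>" unfolding \<D>_def using \<Gamma>.one_closed by blast
  ultimately show "\<exists>K\<ge>1. \<forall>A\<in>\<C>. quasicircle K A" by blast
qed

theorem corollary1:
  fixes \<Gamma> \<Gamma>\<^sub>0 :: "(complex^2^2) set set"
  assumes "subgroup \<Gamma> PSL2C" and "subgroup \<Gamma>\<^sub>0 PSL2C"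
    and "\<Gamma>\<^sub>0 \<subseteq> \<Gamma>" and "finite (rcosets\<^bsub>PSL2C\<lparr>carrier := \<Gamma>\<rparr>\<^esub> \<Gamma>\<^sub>0)"
  shows "BH_condition \<Gamma> \<longleftrightarrow> BH_condition \<Gamma>\<^sub>0"
  using BH_condition_finite_index[OF assms(1,2,4)] BH_condition_mono[OF assms(3)] by blast

end
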